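(* Let $\rho\colon G_{\widehat I}\to\mathbb{U}_n$ be a globalization for $\mathcal{G}_{\widehat I,I}$, let $j\in J\setminus\widehat I$, and suppose that $\rho$ maps the image of $Z_j$ in $G_{\widehat I}$ into $\mathbb{V}_n$, so that the linking invariant $[\widehat I,I,j]\colon Z_j\to R^+$ is defined. Let $\sigma\in Z_j$ and $\hat\sigma\in\hat Z_j$ satisfy $\mathrm{res}_j(\sigma)=\hat\lambda_T(\hat\sigma)$. Then $$[\widehat I,I,j](\sigma)=\epsilon_I(\hat\sigma),$$ where $\epsilon_I(\hat\sigma)$ is the coefficient of $x_{i_1}\cdots x_{i_n}$ in the Magnus expansion $\Lambda(\hat\sigma)$.
   Context: Let $p$ be a prime and $R=\mathbb{Z}_p$ or $R=\mathbb{Z}/q$ for a $p$-power $q$. $\mathbb{U}_n$ is the group of unipotent upper-triangular $(n+1)\times(n+1)$ matrices over $R$, $\mathbb{V}_n=\{\mathrm{Id}+rE_{1,n+1}: r\in R\}$, and $\mathrm{pr}_{1,n+1}$ is the projection on the $(1,n+1)$-entry (an isomorphism $\mathbb{V}_n\to R^+$). Let $G$ be a pro-$p$ group with closed subgroups $Z_j,T_j$ ($j\in J$), $T_j$ normal in $Z_j$, and $T_j\cong\mathbb{Z}_p$ with a fixed generator $\tau_j$. Let $I=\{i_1,\ldots,i_n\}\subseteq J$ consist of $n\geq1$ distinct elements, also regarded as the word $(i_1\cdots i_n)$, with $Z_i=T_i\rtimes\bar Z_i$ ($\bar Z_i=Z_i/T_i$) for $i\in I$, and let $I\subseteq\widehat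 I\subseteq J$. Let $N_{\widehat I}$ be the closed normal subgroup of $G$ generated by $T_j$, $j\in J\setminus\widehat I$, and $G_{\widehat I}=G/N_{\widehat I}$; $\mathrm{res}_j\colon Z_j\to G_{\widehat I}$ is the natural map. Assume that the images of $T_i$, $i\in I$, generate $G_{\widehat I}$ as a pro-$p$ group. For $j\in J$ let $\bar\pi_j\colon T_j\to R^+$ be the epimorphism with $\tau_j\mapsto1$, and $\pi_j\colon T_j\to\mathbb{U}_n$ given by $\pi_j(\tau)=\mathrm{Id}+\bar\pi_j(\tau)E_{l,l+1}$ if $j=i_l$, and $\pi_j=\mathrm{Id}$ if $j\notin I$. The linking structure $\mathcal{G}_{\widehat I,I}$ is $(G_{\widehat I},\mathbb{U}_n,Z_i,T_i,\mathrm{res}_i,\pi_i)_{i\in I}$; a globalization for it is a pro-$p$ homomorphism $\rho\colon G_{\widehat I}\to\mathbb{U}_n$ with $\rho\circ\mathrm{res}_i=\pi_i$ on $T_i$ for every $i\in I$. For $j\in J\setminus\widehat I$ with $\rho(\mathrm{res}_j(Z_j))\subseteq\mathbb{V}_n$, the linking invariant is the homomorphism $[\widehat I,I,j]=\mathrm{pr}_{1,n+1}\circ\rho\circ\mathrm{res}_j\colon Z_j\to R^+$. $\hat T=\star_{i\in I}T_i$ is the free pro-$p$ product (a free pro-$p$ group on the $\tau_i$, $i\in I$), $\hat\lambda_T\colon\hat T\to G_{\widehat I}$ is the epimorphism induced by the $\mathrm{res}_i|_{T_i}$, and $\hat Z_j=\hat\lambda_T^{-1}(\mathrm{res}_j(Z_j))$.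 The Magnus homomorphism $\Lambda\colon\hat T\to R\langle\langle X\rangle\rangle^{\times,1}$ goes to the group of formal power series with constant term $1$ in non-commuting variables $x_i$ over $R$, and is the continuous homomorphism with $\Lambda(\tau_i)=1+x_i$; one writes $\Lambda(\tau)=\sum_w\epsilon_w(\tau)x_w$, $w$ ranging over finite words, with $x_w=x_{k_1}\cdots x_{k_s}$ for $w=(k_1\cdots k_s)$. *)

theory Defs
  imports
    "HOL-Analysis.Analysis"
    "HOL-Algebra.QuotRing"
    "HOL-Algebra.IntRing"
    "HOL-Computational_Algebra.Primes"
    "Jordan_Normal_Form.Matrix"
begin

definition topological_group :: "('a, 'm) monoid_scheme \<Rightarrow> 'a topology \<Rightarrow> bool" where
  "topological_group G TG \<longleftrightarrow>
     group G \<and> topspace TG = carrier G \<and>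
     continuous_map (prod_topology TG TG) TG (\<lambda>(x, y). x \<otimes>\<^bsub>G\<^esub> y) \<and>
     continuous_map TG TG (\<lambda>x. inv\<^bsub>G\<^esub> x)"

text \<open>
  A profinite group is a compact Hausdorff topological group whose open subgroups form a
  neighbourhood base at the identity; it is pro-\<open>p\<close> if all its open normal subgroups have
  \<open>p\<close>-power index.
\<close>

definition profinite_group :: "('a, 'm) monoid_scheme \<Rightarrow> 'a topology \<Rightarrow> bool" where
  "profinite_group G TG \<longleftrightarrow>
     topological_group G TG \<and> compact_space TG \<and> Hausdorff_space TG \<and>
     (\<forall>U. openin TG U \<and> \<one>\<^bsub>G\<^esub> \<in> U \<longrightarrow> (\<exists>H. subgroup H G \<and> openin TG H \<and> H \<subseteq> U))"

definition pro_p_group :: "nat \<Rightarrow> ('a, 'm) monoid_scheme \<Rightarrow> 'a topology \<Rightarrow> bool" where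
  "pro_p_group p G TG \<longleftrightarrow>
     profinite_group G TG \<and>
     (\<forall>N. N \<lhd> G \<and> openin TG N \<longrightarrow> (\<exists>k. card (rcosets\<^bsub>G\<^esub> N) = p ^ k))"

definition continuous_hom ::
  "('a, 'm) monoid_scheme \<Rightarrow> 'a topology \<Rightarrow> ('b, 'k) monoid_scheme \<Rightarrow> 'b topology \<Rightarrow> ('a \<Rightarrow> 'b) set" where
  "continuous_hom G TG H TH = {f \<in> hom G H. continuous_map TG TH f}"

definition topologically_isomorphic ::
  "('a, 'm) monoid_scheme \<Rightarrow> 'a topology \<Rightarrow> ('b, 'k) monoid_scheme \<Rightarrow> 'b topology \<Rightarrow> bool" where
  "topologically_isomorphic G TG H TH \<longleftrightarrow> (\<exists>f. f \<in> iso G H \<and> homeomorphic_map TG TH f)"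

definition closed_subgroup_generated :: "('a, 'm) monoid_scheme \<Rightarrow> 'a topology \<Rightarrow> 'a set \<Rightarrow> 'a set" where
  "closed_subgroup_generated G TG S = \<Inter>{H. subgroup H G \<and> closedin TG H \<and> S \<subseteq> H}"

definition closed_normal_subgroup_generated :: "('a, 'm) monoid_scheme \<Rightarrow> 'a topology \<Rightarrow> 'a set \<Rightarrow> 'a set" where
  "closed_normal_subgroup_generated G TG S = \<Inter>{N. N \<lhd> G \<and> closedin TG N \<and> S \<subseteq> N}"

abbreviation subgrp :: "('a, 'm) monoid_scheme \<Rightarrow> 'a set \<Rightarrow> ('a, 'm) monoid_scheme" where
  "subgrp G H \<equiv> G\<lparr>carrier := H\<rparr>"

definition quotient_group_topology :: "('a, 'm) monoid_scheme \<Rightarrow> 'a topology \<Rightarrow> 'a set \<Rightarrow> 'a set topology" where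
  "quotient_group_topology G TG N =
     topology (\<lambda>U. U \<subseteq> carrier (G Mod N) \<and> openin TG {g \<in> topspace TG. N #>\<^bsub>G\<^esub> g \<in> U})"

lemma openin_quotient_group_topology:
  "openin (quotient_group_topology G TG N) U \<longleftrightarrow>
     U \<subseteq> carrier (G Mod N) \<and> openin TG {g \<in> topspace TG. N #>\<^bsub>G\<^esub> g \<in> U}"
proof -
  have "istopology (\<lambda>U. U \<subseteq> carrier (G Mod N) \<and> openin TG {g \<in> topspace TG. N #>\<^bsub>G\<^esub> g \<in> U})"
    unfolding istopology_def
  proof (intro conjI allI impI)
    fix S S' assume "S \<subseteq> carrier (G Mod N) \<and> openin TG {g \<in> topspace TG. N #>\<^bsub>G\<^esub> g \<in> S}"
      and "S' \<subseteq> carrier (G Mod N) \<and> openin TG {g \<in> topspace TG. N #>\<^bsub>G\<^esub> g \<in> S'}"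
    moreover have "{g \<in> topspace TG. N #>\<^bsub>G\<^esub> g \<in> S \<inter> S'} =
        {g \<in> topspace TG. N #>\<^bsub>G\<^esub> g \<in> S} \<inter> {g \<in> topspace TG. N #>\<^bsub>G\<^esub> g \<in> S'}"
      by auto
    ultimately show "S \<inter> S' \<subseteq> carrier (G Mod N)"
      and "openin TG {g \<in> topspace TG. N #>\<^bsub>G\<^esub> g \<in> S \<inter> S'}"
      by auto
  next
    fix K assume K: "\<forall>S\<in>K. S \<subseteq> carrier (G Mod N) \<and> openin TG {g \<in> topspace TG. N #>\<^bsub>G\<^esub> g \<in> S}"
    then show "\<Union>K \<subseteq> carrier (G Mod N)" by auto
    have "{g \<in> topspace TG. N #>\<^bsub>G\<^esub> g \<in> \<Union>K} = (\<Union>S\<in>K. {g \<in> topspace TG. N #>\<^bsub>G\<^esub> g \<in> S})"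
      by auto
    with K show "openin TG {g \<in> topspace TG. N #>\<^bsub>G\<^esub> g \<in> \<Union>K}" by auto
  qed
  then show ?thesis by (simp add: quotient_group_topology_def)
qed

text \<open>
  \<open>Z = T \<rtimes> (Z/T)\<close> in the category of profinite groups: the projection \<open>Z \<rightarrow> Z/T\<close> has a continuous
  homomorphic section, i.e. \<open>T\<close> has a closed complement in \<open>Z\<close>.
\<close>

definition splits_over :: "('a, 'm) monoid_scheme \<Rightarrow> 'a topology \<Rightarrow> 'a set \<Rightarrow> 'a set \<Rightarrow> bool" where
  "splits_over G TG Z T \<longleftrightarrow>
     T \<lhd> subgrp G Z \<and>
     (\<exists>C. subgroup C G \<and> closedin TG C \<and> C \<subseteq> Z \<and> T \<inter> C = {\<one>\<^bsub>G\<^esub>} \<and> T <#>\<^bsub>G\<^esub> C = Z)"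

text \<open>
  The universal property of the free pro-\<open>p\<close> product (coproduct) of the groups \<open>A i\<close>, \<open>i \<in> I\<close>.
  A formula cannot quantify over all types, so the test groups \<open>H\<close> have carriers in the
  continuum-sized type \<^typ>\<open>nat \<Rightarrow> nat\<close>.  Up to isomorphism this covers all topologically finitely
  generated pro-\<open>p\<close> groups, in particular all finite \<open>p\<close>-groups.  When \<open>I\<close> is finite
  and the \<open>A i\<close> are topologically finitely generated, the property for these \<open>H\<close> implies it
  for pro-\<open>p\<close> groups of any size: for existence replace \<open>H\<close> by the closed subgroup generated by
  the images of the \<open>A i\<close>, and for uniqueness pass to the finite quotients of \<open>H\<close>.
\<close>

definition is_free_pro_p_product ::
  "nat \<Rightarrow> 'j set \<Rightarrow> ('j \<Rightarrow> ('a, 'm) monoid_scheme) \<Rightarrow> ('j \<Rightarrow> 'a topology) \<Rightarrow>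
   't monoid \<Rightarrow> 't topology \<Rightarrow> ('j \<Rightarrow> 'a \<Rightarrow> 't) \<Rightarrow> bool" where
  "is_free_pro_p_product p I A TA F TF \<iota> \<longleftrightarrow>
     pro_p_group p F TF \<and>
     (\<forall>i\<in>I. \<iota> i \<in> continuous_hom (A i) (TA i) F TF) \<and>
     (\<forall>(H :: (nat \<Rightarrow> nat) monoid) TH f.
        pro_p_group p H TH \<and> (\<forall>i\<in>I. f i \<in> continuous_hom (A i) (TA i) H TH) \<longrightarrow>
        (\<exists>h \<in> continuous_hom F TF H TH.
           (\<forall>i\<in>I. \<forall>a\<in>carrier (A i). h (\<iota> i a) = f i a) \<and>
           (\<forall>h' \<in> continuous_hom F TF H TH.
              (\<forall>i\<in>I. \<forall>a\<in>carrier (A i). h' (\<iota> i a) = f i a) \<longrightarrow>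
              (\<forall>x\<in>carrier F. h' x = h x))))"

text \<open>
  The ring of \<open>p\<close>-adic integers as the inverse limit of the rings \<open>\<int>/p\<^sup>n\<close>: an element is the
  compatible sequence of its least nonnegative residues modulo \<open>p\<^sup>n\<close>.
\<close>

definition padic_int :: "nat \<Rightarrow> (nat \<Rightarrow> int) ring" where
  "padic_int p =
     \<lparr>carrier = {a. \<forall>n. a n \<in> {0..<int p ^ n} \<and> a (Suc n) mod int p ^ n = a n},
      monoid.mult = (\<lambda>a b n. (a n * b n) mod int p ^ n),
      one = (\<lambda>n. 1 mod int p ^ n),
      ring.zero = (\<lambda>n. 0),
      add = (\<lambda>a b n. (a n + b n) mod int p ^ n)\<rparr>"

definition padic_topology :: "nat \<Rightarrow> (nat \<Rightarrow> int) topology" where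
  "padic_topology p =
     subtopology (product_topology (\<lambda>n. discrete_topology {0..<int p ^ n}) UNIV) (carrier (padic_int p))"

text \<open>
  The coefficient ring is a type \<open>'r\<close> which, as a topological ring, is a copy of the \<open>p\<close>-adic
  integers or of the discrete ring \<open>\<int>/p\<^sup>k\<close>, \<open>k \<ge> 1\<close>.
\<close>

definition ring_of_type :: "'r::comm_ring_1 itself \<Rightarrow> 'r ring" where
  "ring_of_type _ = \<lparr>carrier = UNIV, monoid.mult = (*), one = 1, ring.zero = 0, add = (+)\<rparr>"

definition is_coefficient_ring :: "nat \<Rightarrow> 'r::{comm_ring_1, topological_space} itself \<Rightarrow> bool" where
  "is_coefficient_ring p R \<longleftrightarrow>
     (\<exists>h. h \<in> ring_iso (ring_of_type R) (padic_int p) \<and>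
          homeomorphic_map euclidean (padic_topology p) h) \<or>
     (\<exists>k\<ge>1. \<exists>h. h \<in> ring_iso (ring_of_type R) (ZFact (int p ^ k)) \<and>
          homeomorphic_map euclidean (discrete_topology (carrier (ZFact (int p ^ k)))) h)"

abbreviation additive_group :: "'r::comm_ring_1 monoid" where
  "additive_group \<equiv> add_monoid (ring_of_type TYPE('r))"

text \<open>
  Matrix indices start at \<open>0\<close>, so the entry with the customary index \<open>(k, l)\<close> is the entry
  \<open>(k - 1, l - 1)\<close> below.
\<close>

definition unipotent_group :: "nat \<Rightarrow> 'r::comm_ring_1 mat monoid" where
  "unipotent_group n =
     \<lparr>carrier = {M \<in> carrier_mat (Suc n) (Suc n). upper_triangular M \<and> (\<forall>i\<le>n. M $$ (i, i) = 1)},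
      monoid.mult = (*),
      one = 1\<^sub>m (Suc n)\<rparr>"

definition unipotent_topology :: "nat \<Rightarrow> 'r::{comm_ring_1, topological_space} mat topology" where
  "unipotent_topology n =
     pullback_topology (carrier (unipotent_group n))
       (\<lambda>M. restrict (\<lambda>ij. M $$ ij) ({..n} \<times> {..n}))
       (product_topology (\<lambda>_. euclidean) ({..n} \<times> {..n}))"

definition matrix_unit :: "nat \<Rightarrow> nat \<Rightarrow> nat \<Rightarrow> 'r::comm_ring_1 mat" where
  "matrix_unit n k l = Matrix.mat (Suc n) (Suc n) (\<lambda>ij. if ij = (k, l) then 1 else 0)"

definition corner_group :: "nat \<Rightarrow> 'r::comm_ring_1 mat set" where
  "corner_group n = {1\<^sub>m (Suc n) + r \<cdot>\<^sub>m matrix_unit n 0 n | r. True}"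

text \<open>
  The set \<open>I = {i\<^sub>1, \<dots>, i\<^sub>n}\<close> is given by the word \<open>w = [i\<^sub>1, \<dots>, i\<^sub>n]\<close> of its distinct elements.
\<close>

definition kernel_outside ::
  "('a, 'm) monoid_scheme \<Rightarrow> 'a topology \<Rightarrow> 'j set \<Rightarrow> ('j \<Rightarrow> 'a set) \<Rightarrow> 'j set \<Rightarrow> 'a set" where
  "kernel_outside G TG J T Ihat = closed_normal_subgroup_generated G TG (\<Union>j\<in>J - Ihat. T j)"

definition linking_local_map :: "'j list \<Rightarrow> ('j \<Rightarrow> 'a \<Rightarrow> 'r::comm_ring_1) \<Rightarrow> 'j \<Rightarrow> 'a \<Rightarrow> 'r mat" where
  "linking_local_map w \<pi>bar j t =
     (if j \<in> set w
      then let l = (THE l. l < length w \<and> w ! l = j)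
           in 1\<^sub>m (Suc (length w)) + \<pi>bar j t \<cdot>\<^sub>m matrix_unit (length w) l (Suc l)
      else 1\<^sub>m (Suc (length w)))"

definition is_globalization ::
  "'q monoid \<Rightarrow> 'q topology \<Rightarrow> ('j \<Rightarrow> 'a set) \<Rightarrow> ('a \<Rightarrow> 'q) \<Rightarrow>
   ('j \<Rightarrow> 'a \<Rightarrow> 'r::{comm_ring_1, topological_space}) \<Rightarrow> 'j list \<Rightarrow> ('q \<Rightarrow> 'r mat) \<Rightarrow> bool" where
  "is_globalization Q TQ T res \<pi>bar w \<rho> \<longleftrightarrow>
     \<rho> \<in> continuous_hom Q TQ (unipotent_group (length w)) (unipotent_topology (length w)) \<and>
     (\<forall>i\<in>set w. \<forall>t\<in>T i. \<rho> (res t) = linking_local_map w \<pi>bar i t)"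

definition linking_invariant :: "nat \<Rightarrow> ('q \<Rightarrow> 'r mat) \<Rightarrow> ('a \<Rightarrow> 'q) \<Rightarrow> 'a \<Rightarrow> 'r" where
  "linking_invariant n \<rho> res \<sigma> = \<rho> (res \<sigma>) $$ (0, n)"

text \<open>
  A series in the variables \<open>x\<^sub>i\<close>, \<open>i \<in> I\<close>, is its coefficient function on words; words with letters
  outside \<open>I\<close> have coefficient \<open>0\<close>.  The topology is that of coefficientwise convergence.
\<close>

definition ncps_mult :: "('j list \<Rightarrow> 'r::comm_ring_1) \<Rightarrow> ('j list \<Rightarrow> 'r) \<Rightarrow> 'j list \<Rightarrow> 'r" where
  "ncps_mult f g v = (\<Sum>k\<le>length v. f (take k v) * g (drop k v))"

definition ncps_one :: "'j list \<Rightarrow> 'r::comm_ring_1" where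
  "ncps_one v = (if v = [] then 1 else 0)"

definition ncps_var :: "'j \<Rightarrow> 'j list \<Rightarrow> 'r::comm_ring_1" where
  "ncps_var i v = (if v = [i] then 1 else 0)"

definition magnus_group :: "'j set \<Rightarrow> ('j list \<Rightarrow> 'r::comm_ring_1) monoid" where
  "magnus_group I =
     \<lparr>carrier = {f. f [] = 1 \<and> (\<forall>v. v \<notin> lists I \<longrightarrow> f v = 0)},
      monoid.mult = ncps_mult,
      one = ncps_one\<rparr>"

definition magnus_topology :: "'j set \<Rightarrow> ('j list \<Rightarrow> 'r::{comm_ring_1, topological_space}) topology" where
  "magnus_topology I =
     subtopology (product_topology (\<lambda>_. euclidean) UNIV) (carrier (magnus_group I))"

definition is_magnus_hom ::
  "'j set \<Rightarrow> 't monoid \<Rightarrow> 't topology \<Rightarrow> ('j \<Rightarrow> 't) \<Rightarrow>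
   ('t \<Rightarrow> 'j list \<Rightarrow> 'r::{comm_ring_1, topological_space}) \<Rightarrow> bool" where
  "is_magnus_hom I F TF x \<Lambda> \<longleftrightarrow>
     \<Lambda> \<in> continuous_hom F TF (magnus_group I) (magnus_topology I) \<and>
     (\<forall>i\<in>I. \<Lambda> (x i) = (\<lambda>v. ncps_one v + ncps_var i v))"

end

theory Submission
  imports Defs
begin

text \<open>
  Let \<open>n\<close> be the length of \<open>w\<close>.  Sending a power series \<open>f\<close> with constant term \<open>1\<close> to the matrix
  whose entry \<open>(a, b)\<close>, \<open>a \<le> b\<close>, is the coefficient of \<open>f\<close> at the segment \<open>take (b - a) (drop a w)\<close> is a
  homomorphism to the unitriangular group (\<open>subword_mat_hom\<close>), and its corner entry is the coefficient
  at \<open>w\<close>.  Composed with the Magnus homomorphism it gives a continuous homomorphism on the free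
  pro-\<open>p\<close> product.  Another one is the globalization \<open>\<rho>\<close> composed with \<open>lamT\<close>.  Both map \<open>\<tau>\<^sub>i\<close>,
  where \<open>i = w ! l\<close>, to \<open>1 + matrix_unit n l (Suc l)\<close> (\<open>subword_mat_generator\<close>).
  The free pro-\<open>p\<close> product is generated by the \<open>\<tau>\<^sub>i\<close>, so the two homomorphisms are equal.
  The theorem compares their corner entries at \<open>\<sigma>hat\<close>.

  The equality of the two homomorphisms is derived from the universal property alone
  (\<open>unipotent_hom_unique\<close>).  The coefficient ring is separated by continuous reductions modulo powers
  of \<open>p\<close> (\<open>coefficient_ring_residually_finite\<close>), so it suffices to compare the two homomorphisms after
  a reduction of the matrix entries.  They then take values in a finite \<open>p\<close>-group of unitriangular
  matrices (\<open>pro_p_unipotent_mod\<close>), where the uniqueness half of the universal property applies.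
\<close>

section \<open>The unitriangular group\<close>

lemma unipotent_carrier_iff:
  "M \<in> carrier (unipotent_group n) \<longleftrightarrow>
     M \<in> carrier_mat (Suc n) (Suc n) \<and>
     (\<forall>i\<le>n. \<forall>j\<le>n. j \<le> i \<longrightarrow> M $$ (i, j) = (if i = j then 1 else 0))"
  by (force simp: unipotent_group_def upper_triangular_def)

lemma unipotent_entry:
  assumes "M \<in> carrier (unipotent_group n)" "i \<le> n" "j \<le> i"
  shows "M $$ (i, j) = (if i = j then 1 else 0)"
  using assms by (auto simp: unipotent_carrier_iff)

lemma unipotent_carrier_mat:
  "M \<in> carrier (unipotent_group n) \<Longrightarrow> M \<in> carrier_mat (Suc n) (Suc n)"
  by (simp add: unipotent_carrier_iff)

lemma index_mult_mat_sum:
  fixes A B :: "'r::comm_ring_1 mat"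
  assumes "A \<in> carrier_mat (Suc n) (Suc n)" "B \<in> carrier_mat (Suc n) (Suc n)" "i \<le> n" "j \<le> n"
  shows "(A * B) $$ (i, j) = (\<Sum>k\<le>n. A $$ (i, k) * B $$ (k, j))"
  using assms by (auto simp: scalar_prod_def lessThan_Suc_atMost atLeast0LessThan intro!: sum.cong)

lemma unipotent_index_mult:
  fixes A B :: "'r::comm_ring_1 mat"
  assumes A: "A \<in> carrier (unipotent_group n)" and B: "B \<in> carrier (unipotent_group n)"
    and "i \<le> n" "j \<le> n"
  shows "(A * B) $$ (i, j) = (\<Sum>k=i..j. A $$ (i, k) * B $$ (k, j))"
proof -
  have "(A * B) $$ (i, j) = (\<Sum>k\<le>n. A $$ (i, k) * B $$ (k, j))"
    using assms by (intro index_mult_mat_sum unipotent_carrier_mat)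
  also have "\<dots> = (\<Sum>k=i..j. A $$ (i, k) * B $$ (k, j))"
    using assms by (intro sum.mono_neutral_right) (auto simp: unipotent_entry not_le)
  finally show ?thesis .
qed

lemma unipotent_mult_closed:
  fixes A B :: "'r::comm_ring_1 mat"
  assumes A: "A \<in> carrier (unipotent_group n)" and B: "B \<in> carrier (unipotent_group n)"
  shows "A * B \<in> carrier (unipotent_group n)"
proof -
  have "(A * B) $$ (i, j) = (if i = j then 1 else 0)" if "i \<le> n" "j \<le> i" for i j
    using that by (subst unipotent_index_mult[OF A B])
      (auto simp: unipotent_entry[OF A] unipotent_entry[OF B])
  then show ?thesis
    using unipotent_carrier_mat[OF A] unipotent_carrier_mat[OF B]
    by (auto simp: unipotent_carrier_iff)
qed

text \<open>
  If all entries on the first \<open>d - 1\<close> superdiagonals of \<open>M = 1 + E\<close> vanish, then multiplication by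
  \<open>Y = 1 - E\<close> gives \<open>1 - E\<^sup>2\<close>, in which the \<open>d\<close>-th superdiagonal vanishes as well.  Clearing one
  superdiagonal after the other leads to the identity matrix; the product of the matrices \<open>Y\<close> is
  the inverse.
\<close>
lemma unipotent_left_inverse:
  fixes M :: "'r::comm_ring_1 mat"
  assumes "M \<in> carrier (unipotent_group n)" "1 \<le> d"
    and "\<And>i j. j \<le> n \<Longrightarrow> i < j \<Longrightarrow> j < i + d \<Longrightarrow> M $$ (i, j) = 0"
  shows "\<exists>X \<in> carrier (unipotent_group n). X * M = 1\<^sub>m (Suc n)"
  using assms
proof (induction "Suc n - d" arbitrary: d M)
  case 0
  have "M = 1\<^sub>m (Suc n)"
  proof (rule eq_matI)
    fix i j assume "i < dim_row (1\<^sub>m (Suc n))" "j < dim_col (1\<^sub>m (Suc n))"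
    then show "M $$ (i, j) = 1\<^sub>m (Suc n) $$ (i, j)"
      using 0 unipotent_entry[OF "0.prems"(1), of i j] by (cases "j \<le> i") auto
  qed (use unipotent_carrier_mat[OF "0.prems"(1)] in auto)
  moreover have "1\<^sub>m (Suc n) \<in> carrier (unipotent_group n :: 'r mat monoid)"
    by (auto simp: unipotent_carrier_iff)
  ultimately show ?case by (metis left_mult_one_mat one_carrier_mat)
next
  case (Suc m)
  define Y where "Y = Matrix.mat (Suc n) (Suc n) (\<lambda>(i, j). if i = j then 1 else - M $$ (i, j))"
  have Y: "Y \<in> carrier (unipotent_group n)"
    using unipotent_entry[OF Suc.prems(1)] by (auto simp: unipotent_carrier_iff Y_def)
  have YM: "Y * M \<in> carrier (unipotent_group n)"
    by (rule unipotent_mult_closed[OF Y Suc.prems(1)])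
  have "\<exists>X \<in> carrier (unipotent_group n). X * (Y * M) = 1\<^sub>m (Suc n)"
  proof (rule Suc.hyps(1)[OF _ YM])
    show "m = Suc n - Suc d" using Suc.hyps(2) by simp
    show "1 \<le> Suc d" by simp
    fix i j assume ij: "j \<le> n" "i < j" "j < i + Suc d"
    have "(Y * M) $$ (i, j) = (\<Sum>k=i..j. Y $$ (i, k) * M $$ (k, j))"
      using ij by (intro unipotent_index_mult[OF Y Suc.prems(1)]) auto
    \<comment> \<open>For \<open>i < k < j \<le> i + d\<close> the entry \<open>(k, j)\<close> is nearer to the diagonal than \<open>d\<close>.\<close>
    also have "\<dots> = (\<Sum>k\<in>{i, j}. Y $$ (i, k) * M $$ (k, j))"
    proof (intro sum.mono_neutral_right ballI)
      fix k assume "k \<in> {i..j} - {i, j}"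
      with ij Suc.prems(2) show "Y $$ (i, k) * M $$ (k, j) = 0"
        by (subst Suc.prems(3)[of j k]) auto
    qed (use ij in auto)
    also have "\<dots> = 0"
      using ij unipotent_entry[OF Suc.prems(1), of j j] by (simp add: Y_def)
    finally show "(Y * M) $$ (i, j) = 0" .
  qed
  then obtain X where "X \<in> carrier (unipotent_group n)" "X * (Y * M) = 1\<^sub>m (Suc n)" by blast
  moreover from this have "X * Y * M = 1\<^sub>m (Suc n)"
    using assoc_mult_mat[of X "Suc n" "Suc n" Y "Suc n" M "Suc n"] Y Suc.prems(1)
    by (auto dest!: unipotent_carrier_mat)
  ultimately show ?case using unipotent_mult_closed[OF _ Y] by blast
qed

lemma group_unipotent_group: "group (unipotent_group n :: 'r::comm_ring_1 mat monoid)"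
proof (rule groupI)
  fix A B C :: "'r mat"
  assume A: "A \<in> carrier (unipotent_group n)" and B: "B \<in> carrier (unipotent_group n)"
    and C: "C \<in> carrier (unipotent_group n)"
  show "A \<otimes>\<^bsub>unipotent_group n\<^esub> B \<in> carrier (unipotent_group n)"
    using unipotent_mult_closed[OF A B] by (simp add: unipotent_group_def)
  show "A \<otimes>\<^bsub>unipotent_group n\<^esub> B \<otimes>\<^bsub>unipotent_group n\<^esub> C =
        A \<otimes>\<^bsub>unipotent_group n\<^esub> (B \<otimes>\<^bsub>unipotent_group n\<^esub> C)"
    using A B C by (auto simp: unipotent_group_def intro!: assoc_mult_mat)
  show "\<one>\<^bsub>unipotent_group n\<^esub> \<otimes>\<^bsub>unipotent_group n\<^esub> A = A"
    using A by (auto simp: unipotent_group_def)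
  show "\<exists>X\<in>carrier (unipotent_group n). X \<otimes>\<^bsub>unipotent_group n\<^esub> A = \<one>\<^bsub>unipotent_group n\<^esub>"
    using unipotent_left_inverse[OF A, of 1] by (auto simp: unipotent_group_def)
qed (auto simp: unipotent_group_def)

section \<open>Unitriangular matrices modulo a prime power\<close>

text \<open>
  The universal property of \<open>is_free_pro_p_product\<close> speaks about test groups whose elements are
  functions \<^typ>\<open>nat \<Rightarrow> nat\<close>.  A unitriangular matrix over \<open>\<int>/q\<close> is therefore coded by its entries above
  the diagonal, as residues in \<open>{0..<q}\<close>, with index pairs coded as natural numbers.
\<close>
definition superdiag :: "nat \<Rightarrow> nat set" where
  "superdiag n = prod_encode ` {(i, j). i < j \<and> j \<le> n}"

definition reduce_mat :: "nat \<Rightarrow> nat \<Rightarrow> int mat \<Rightarrow> nat \<Rightarrow> nat" where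
  "reduce_mat q n A = (\<lambda>k\<in>superdiag n. nat (A $$ prod_decode k mod int q))"

text \<open>
  The unitriangular integer matrix whose entries are the coded residues: a section of \<open>reduce_mat\<close>.
\<close>
definition lift_mat :: "nat \<Rightarrow> (nat \<Rightarrow> nat) \<Rightarrow> int mat" where
  "lift_mat n f = Matrix.mat (Suc n) (Suc n)
     (\<lambda>(i, j). if i = j then 1 else if i < j then int (f (prod_encode (i, j))) else 0)"

definition unipotent_mod :: "nat \<Rightarrow> nat \<Rightarrow> (nat \<Rightarrow> nat) monoid" where
  "unipotent_mod q n =
     \<lparr>carrier = superdiag n \<rightarrow>\<^sub>E {..<q},
      monoid.mult = (\<lambda>f g. reduce_mat q n (lift_mat n f * lift_mat n g)),
      one = reduce_mat q n (1\<^sub>m (Suc n))\<rparr>"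

text \<open>
  A ring homomorphism to \<open>\<int>/q\<close>, given by arbitrary integer representatives of its values.  In this
  form the canonical homomorphism from \<open>\<int>\<close> is the identity function.
\<close>
definition residue_map :: "nat \<Rightarrow> ('r::comm_ring_1 \<Rightarrow> int) \<Rightarrow> bool" where
  "residue_map q \<theta> \<longleftrightarrow>
     (\<forall>a b. \<theta> (a + b) mod int q = (\<theta> a + \<theta> b) mod int q) \<and>
     (\<forall>a b. \<theta> (a * b) mod int q = (\<theta> a * \<theta> b) mod int q) \<and>
     \<theta> 1 mod int q = 1 mod int q"

lemma residue_map_add: "residue_map q \<theta> \<Longrightarrow> \<theta> (a + b) mod int q = (\<theta> a + \<theta> b) mod int q"
  and residue_map_mult: "residue_map q \<theta> \<Longrightarrow> \<theta> (a * b) mod int q = (\<theta> a * \<theta> b) mod int q"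
  and residue_map_one: "residue_map q \<theta> \<Longrightarrow> \<theta> 1 mod int q = 1 mod int q"
  by (auto simp: residue_map_def)

lemma residue_map_zero:
  assumes "residue_map q \<theta>" shows "\<theta> 0 mod int q = 0"
  using residue_map_add[OF assms, of 0 0] by (simp add: mod_eq_dvd_iff)

lemma residue_map_sum:
  assumes "residue_map q \<theta>"
  shows "\<theta> (\<Sum>k\<in>K. f k) mod int q = (\<Sum>k\<in>K. \<theta> (f k)) mod int q"
proof (induction K rule: infinite_finite_induct)
  case (insert k K)
  then show ?case
    by (simp add: residue_map_add[OF assms]) (metis mod_add_right_eq)
qed (simp_all add: residue_map_zero[OF assms])

lemma finite_superdiag: "finite (superdiag n)"
proof -
  have "{(i, j). i < j \<and> j \<le> n} \<subseteq> {..n} \<times> {..n}" by auto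
  then show ?thesis unfolding superdiag_def by (meson finite_SigmaI finite_atMost finite_imageI finite_subset)
qed

lemma superdiagE:
  assumes "k \<in> superdiag n"
  obtains i j where "k = prod_encode (i, j)" "i < j" "j \<le> n"
  using assms by (auto simp: superdiag_def)

lemma superdiagI: "i < j \<Longrightarrow> j \<le> n \<Longrightarrow> prod_encode (i, j) \<in> superdiag n"
  by (auto simp: superdiag_def)

lemma reduce_mat_in_carrier: "q > 0 \<Longrightarrow> reduce_mat q n A \<in> superdiag n \<rightarrow>\<^sub>E {..<q}"
  by (auto simp: reduce_mat_def nat_less_iff)

lemma reduce_mat_eq_iff:
  assumes "q > 0"
  shows "reduce_mat q n A = reduce_mat q n B \<longleftrightarrow>
    (\<forall>i j. i < j \<longrightarrow> j \<le> n \<longrightarrow> A $$ (i, j) mod int q = B $$ (i, j) mod int q)"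
proof -
  have "reduce_mat q n A = reduce_mat q n B \<longleftrightarrow>
     (\<forall>k\<in>superdiag n. nat (A $$ prod_decode k mod int q) = nat (B $$ prod_decode k mod int q))"
    by (auto simp: reduce_mat_def fun_eq_iff restrict_def)
  also have "\<dots> \<longleftrightarrow> (\<forall>i j. i < j \<longrightarrow> j \<le> n \<longrightarrow> A $$ (i, j) mod int q = B $$ (i, j) mod int q)"
    using assms by (auto simp: superdiag_def eq_nat_nat_iff)
  finally show ?thesis .
qed

lemma lift_mat_unipotent: "lift_mat n f \<in> carrier (unipotent_group n)"
  by (auto simp: lift_mat_def unipotent_carrier_iff)

lemma reduce_lift_mat:
  assumes "f \<in> superdiag n \<rightarrow>\<^sub>E {..<q}" shows "reduce_mat q n (lift_mat n f) = f"
proof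
  fix k show "reduce_mat q n (lift_mat n f) k = f k"
  proof (cases "k \<in> superdiag n")
    case True
    then obtain i j where "k = prod_encode (i, j)" "i < j" "j \<le> n" by (rule superdiagE)
    moreover have "f k < q" using assms True by auto
    ultimately show ?thesis using True by (simp add: reduce_mat_def lift_mat_def flip: of_nat_mod)
  next
    case False
    then show ?thesis using PiE_arb[OF assms False] by (simp add: reduce_mat_def)
  qed
qed

lemma lift_reduce_mat:
  assumes q: "q > 0" and \<theta>: "residue_map q \<theta>" and M: "M \<in> carrier (unipotent_group n)"
    and "i \<le> n" "j \<le> n"
  shows "lift_mat n (reduce_mat q n (map_mat \<theta> M)) $$ (i, j) mod int q = \<theta> (M $$ (i, j)) mod int q"
  using assms unipotent_entry[OF M, of i j] unipotent_carrier_mat[OF M]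
  by (cases i j rule: linorder_cases)
     (auto simp: lift_mat_def reduce_mat_def superdiagI residue_map_zero residue_map_one)

lemma reduce_mat_hom:
  fixes \<theta> :: "'r::comm_ring_1 \<Rightarrow> int"
  assumes q: "q > 0" and \<theta>: "residue_map q \<theta>"
  shows "(\<lambda>M. reduce_mat q n (map_mat \<theta> M)) \<in> hom (unipotent_group n) (unipotent_mod q n)"
proof (rule homI)
  fix A B :: "'r mat"
  assume A: "A \<in> carrier (unipotent_group n)" and B: "B \<in> carrier (unipotent_group n)"
  let ?L = "\<lambda>M. lift_mat n (reduce_mat q n (map_mat \<theta> M))"
  have "\<theta> ((A * B) $$ (i, j)) mod int q = (?L A * ?L B) $$ (i, j) mod int q"
    if ij: "i < j" "j \<le> n" for i j
  proof -
    have "\<theta> ((A * B) $$ (i, j)) mod int q = \<theta> (\<Sum>k\<le>n. A $$ (i, k) * B $$ (k, j)) mod int q"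
      using ij A B by (subst index_mult_mat_sum[of _ n]) (auto dest: unipotent_carrier_mat)
    also have "\<dots> = (\<Sum>k\<le>n. \<theta> (A $$ (i, k) * B $$ (k, j)) mod int q) mod int q"
      by (simp add: residue_map_sum[OF \<theta>] mod_sum_eq)
    also have "(\<Sum>k\<le>n. \<theta> (A $$ (i, k) * B $$ (k, j)) mod int q) =
        (\<Sum>k\<le>n. ?L A $$ (i, k) * ?L B $$ (k, j) mod int q)"
    proof (rule sum.cong[OF refl])
      fix k assume "k \<in> {..n}"
      then show "\<theta> (A $$ (i, k) * B $$ (k, j)) mod int q = ?L A $$ (i, k) * ?L B $$ (k, j) mod int q"
        using ij lift_reduce_mat[OF q \<theta> A, of i k] lift_reduce_mat[OF q \<theta> B, of k j]
        by (simp add: residue_map_mult[OF \<theta>]) (metis mod_mult_eq)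
    qed
    also have "(\<Sum>k\<le>n. ?L A $$ (i, k) * ?L B $$ (k, j) mod int q) mod int q =
        (?L A * ?L B) $$ (i, j) mod int q"
      using ij by (subst index_mult_mat_sum[of _ n])
        (auto simp: mod_sum_eq intro!: unipotent_carrier_mat lift_mat_unipotent)
    finally show ?thesis .
  qed
  moreover have "map_mat \<theta> (A * B) $$ (i, j) = \<theta> ((A * B) $$ (i, j))" if "i < j" "j \<le> n" for i j
    using that A B by (auto dest!: unipotent_carrier_mat)
  ultimately show "reduce_mat q n (map_mat \<theta> (A \<otimes>\<^bsub>unipotent_group n\<^esub> B)) =
      reduce_mat q n (map_mat \<theta> A) \<otimes>\<^bsub>unipotent_mod q n\<^esub> reduce_mat q n (map_mat \<theta> B)"
    by (simp add: unipotent_mod_def unipotent_group_def reduce_mat_eq_iff[OF q])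
qed (use reduce_mat_in_carrier[OF q] in \<open>simp add: unipotent_mod_def\<close>)

text \<open>
  Reduction maps the group of unitriangular integer matrices homomorphically onto \<open>unipotent_mod\<close>,
  and a homomorphic image of a group is a group.
\<close>
lemma group_unipotent_mod:
  assumes "q > 0" shows "group (unipotent_mod q n)"
proof -
  interpret U: group "unipotent_group n :: int mat monoid" by (rule group_unipotent_group)
  have [simp]: "map_mat (\<lambda>x. x) A = A" for A :: "int mat" by (rule eq_matI) auto
  have hom: "reduce_mat q n \<in> hom (unipotent_group n) (unipotent_mod q n)"
    using reduce_mat_hom[OF assms, of "\<lambda>x. x" n] by (simp add: residue_map_def)
  have "reduce_mat q n ` carrier (unipotent_group n) = carrier (unipotent_mod q n)"
  proof
    show "reduce_mat q n ` carrier (unipotent_group n) \<subseteq> carrier (unipotent_mod q n)"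
      using hom by (auto simp: hom_def)
    show "carrier (unipotent_mod q n) \<subseteq> reduce_mat q n ` carrier (unipotent_group n)"
    proof
      fix f assume "f \<in> carrier (unipotent_mod q n)"
      then have "reduce_mat q n (lift_mat n f) = f"
        by (intro reduce_lift_mat) (simp add: unipotent_mod_def)
      then show "f \<in> reduce_mat q n ` carrier (unipotent_group n)"
        using lift_mat_unipotent by (metis imageI)
    qed
  qed
  moreover have "reduce_mat q n \<one>\<^bsub>unipotent_group n\<^esub> = \<one>\<^bsub>unipotent_mod q n\<^esub>"
    by (simp add: unipotent_mod_def unipotent_group_def)
  ultimately show ?thesis using U.hom_imp_img_group[OF hom] by simp
qed

lemma finite_p_group_pro_p:
  fixes H :: "('b, 'k) monoid_scheme"
  assumes "prime p" "group H" "card (carrier H) = p ^ e"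
  shows "pro_p_group p H (discrete_topology (carrier H))"
proof -
  interpret group H by fact
  have fin: "finite (carrier H)"
    using assms by (metis card.infinite not_prime_0 power_not_zero)
  have "topological_group H (discrete_topology (carrier H))"
    unfolding topological_group_def
    by (auto simp: is_group group_axioms simp flip: prod_topology_discrete_topology)
  moreover have "compact_space (discrete_topology (carrier H))"
    using fin by (simp add: compact_space_discrete_topology)
  moreover have "\<exists>K. subgroup K H \<and> openin (discrete_topology (carrier H)) K \<and> K \<subseteq> U"
    if "\<one>\<^bsub>H\<^esub> \<in> U" for U
    using that triv_subgroup by (intro exI[of _ "{\<one>\<^bsub>H\<^esub>}"]) auto
  moreover have "\<exists>k. card (rcosets\<^bsub>H\<^esub> N) = p ^ k" if "N \<lhd> H" for N
  proof -
    have "card (rcosets\<^bsub>H\<^esub> N) dvd p ^ e"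
      using lagrange[OF normal_imp_subgroup[OF that]] assms(3) by (metis dvd_triv_left order_def)
    then show ?thesis using divides_primepow_nat[OF assms(1)] by blast
  qed
  ultimately show ?thesis
    by (auto simp: pro_p_group_def profinite_group_def Hausdorff_space_discrete_topology)
qed

text \<open>
  The superdiagonal entries are free, so that the order is a power of \<open>p ^ m\<close>.
\<close>
lemma pro_p_unipotent_mod:
  assumes "prime p"
  shows "pro_p_group p (unipotent_mod (p ^ m) n) (discrete_topology (carrier (unipotent_mod (p ^ m) n)))"
proof (rule finite_p_group_pro_p[OF assms])
  show "group (unipotent_mod (p ^ m) n)"
    using assms by (intro group_unipotent_mod) (simp add: prime_gt_0_nat)
  show "card (carrier (unipotent_mod (p ^ m) n)) = p ^ (m * card (superdiag n))"
    by (simp add: unipotent_mod_def card_PiE finite_superdiag power_mult)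
qed

text \<open>
  A reduced matrix depends only on finitely many entries, each of which has a locally constant residue.
\<close>
lemma continuous_map_reduce_mat:
  fixes \<theta> :: "'r::{comm_ring_1, topological_space} \<Rightarrow> int"
  assumes q: "q > 0" and \<theta>: "continuous_map euclidean (discrete_topology UNIV) \<theta>"
    and h: "\<And>s. s \<in> topspace X \<Longrightarrow> h s \<in> carrier (unipotent_group n)"
    and cont: "\<And>i j. i < j \<Longrightarrow> j \<le> n \<Longrightarrow> continuous_map X euclidean (\<lambda>s. h s $$ (i, j))"
  shows "continuous_map X (discrete_topology (carrier (unipotent_mod q n)))
           (\<lambda>s. reduce_mat q n (map_mat \<theta> (h s)))" (is "continuous_map X _ ?g")
  unfolding continuous_map_def
proof (intro conjI allI impI funcsetI)
  fix s show "?g s \<in> topspace (discrete_topology (carrier (unipotent_mod q n)))"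
    using reduce_mat_in_carrier[OF q] by (simp add: unipotent_mod_def)
next
  fix U show "openin X {s \<in> topspace X. ?g s \<in> U}"
  proof (subst openin_subopen, intro ballI)
    fix s assume s: "s \<in> {s \<in> topspace X. ?g s \<in> U}"
    define P where "P = {(i, j). i < j \<and> j \<le> n}"
    define V where "V = (\<Inter>ij\<in>P. {x \<in> topspace X. \<theta> (h x $$ ij) \<in> {\<theta> (h s $$ ij)}}) \<inter> topspace X"
    have "P \<subseteq> {..n} \<times> {..n}" by (auto simp: P_def)
    then have "finite P" by (rule finite_subset) simp
    moreover have "openin X {x \<in> topspace X. \<theta> (h x $$ ij) \<in> {\<theta> (h s $$ ij)}}" if ij: "ij \<in> P" for ij
    proof -
      have "continuous_map X euclidean (\<lambda>x. h x $$ ij)"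
        using ij cont by (auto simp: P_def)
      then have "continuous_map X (discrete_topology UNIV) (\<theta> \<circ> (\<lambda>x. h x $$ ij))"
        using \<theta> by (rule continuous_map_compose)
      then show ?thesis
        by (auto simp: comp_def dest!: openin_continuous_map_preimage[where U = "{\<theta> (h s $$ ij)}"])
    qed
    ultimately have "openin X V" unfolding V_def by (rule openin_INT)
    moreover have "s \<in> V" using s by (auto simp: V_def)
    moreover have "V \<subseteq> {s \<in> topspace X. ?g s \<in> U}"
    proof
      fix x assume x: "x \<in> V"
      then have "x \<in> topspace X" by (simp add: V_def)
      have "\<theta> (h x $$ (i, j)) = \<theta> (h s $$ (i, j))" if "i < j" "j \<le> n" for i j
        using that x by (auto simp: V_def P_def)
      then have "?g x = ?g s"
        using h[OF \<open>x \<in> topspace X\<close>] h[of s] s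
        by (auto simp: reduce_mat_eq_iff[OF q] dest!: unipotent_carrier_mat)
      then show "x \<in> {s \<in> topspace X. ?g s \<in> U}"
        using s \<open>x \<in> topspace X\<close> by simp
    qed
    ultimately show "\<exists>V. openin X V \<and> s \<in> V \<and> V \<subseteq> {s \<in> topspace X. ?g s \<in> U}" by blast
  qed
qed

section \<open>Homomorphisms on a free pro-\<open>p\<close> product\<close>

text \<open>
  The set where two continuous homomorphisms agree is a closed subgroup, because the target is
  Hausdorff.
\<close>
lemma hom_eq_on_closed_subgroup_generated:
  assumes G: "group G" "topspace TG = carrier G"
    and T: "subgroup T G" "closedin TG T" "closed_subgroup_generated G TG S = T"
    and H: "group H" "Hausdorff_space TH"
    and f: "f \<in> continuous_hom (subgrp G T) (subtopology TG T) H TH"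
    and g: "g \<in> continuous_hom (subgrp G T) (subtopology TG T) H TH"
    and S: "\<And>s. s \<in> S \<Longrightarrow> f s = g s" "S \<subseteq> T" and "t \<in> T"
  shows "f t = g t"
proof -
  interpret G: group G by fact
  interpret T: group "subgrp G T" using T(1) G.subgroup_imp_group by blast
  interpret H: group H by fact
  interpret f: group_hom "subgrp G T" H f
    using f by unfold_locales (simp add: continuous_hom_def)
  interpret g: group_hom "subgrp G T" H g
    using g by unfold_locales (simp add: continuous_hom_def)
  let ?E = "{t \<in> T. f t = g t}"
  have TG: "T \<subseteq> carrier G" using T(1) by (rule subgroup.subset)
  have "subgroup ?E G"
  proof
    show "?E \<subseteq> carrier G" using TG by auto
    show "\<one>\<^bsub>G\<^esub> \<in> ?E"
      using f.hom_one g.hom_one subgroup.one_closed[OF T(1)] by simp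
    fix x y assume x: "x \<in> ?E" and y: "y \<in> ?E"
    show "x \<otimes>\<^bsub>G\<^esub> y \<in> ?E"
      using x y f.hom_mult[of x y] g.hom_mult[of x y] subgroup.m_closed[OF T(1)] by simp
    show "inv\<^bsub>G\<^esub> x \<in> ?E"
      using x f.hom_inv[of x] g.hom_inv[of x] subgroup.m_inv_closed[OF T(1)] G.m_inv_consistent[OF T(1), of x]
      by simp
  qed
  moreover have "closedin TG ?E"
  proof -
    have "closedin (subtopology TG T) {x \<in> topspace (subtopology TG T). f x = g x}"
      using f g H(2) by (intro closedin_continuous_maps_eq) (auto simp: continuous_hom_def)
    moreover have "topspace (subtopology TG T) = T" using TG G(2) by (simp add: Int_absorb1)
    moreover have "?E = {x \<in> topspace TG. x \<in> T \<and> f x = g x}" using TG G(2) by auto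
    ultimately show ?thesis using T(2) by (simp add: closedin_closed_subtopology)
  qed
  ultimately have "closed_subgroup_generated G TG S \<subseteq> ?E"
    using S by (auto simp: closed_subgroup_generated_def)
  then show ?thesis using T(3) \<open>t \<in> T\<close> by auto
qed

text \<open>
  Agreement at the topological generators \<open>\<tau> i\<close> spreads to the factors \<open>T i\<close>; the uniqueness half
  of the universal property then applies.
\<close>
lemma free_pro_p_product_hom_unique:
  fixes H :: "(nat \<Rightarrow> nat) monoid"
  assumes G: "group G" "topspace TG = carrier G"
    and T: "\<And>i. i \<in> I \<Longrightarrow> subgroup (T i) G \<and> closedin TG (T i) \<and> \<tau> i \<in> T i \<and>
              closed_subgroup_generated G TG {\<tau> i} = T i"
    and F: "is_free_pro_p_product p I (\<lambda>i. subgrp G (T i)) (\<lambda>i. subtopology TG (T i)) F TF \<iota>"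
    and H: "pro_p_group p H TH"
    and f: "f \<in> continuous_hom F TF H TH" and g: "g \<in> continuous_hom F TF H TH"
    and eq: "\<And>i. i \<in> I \<Longrightarrow> f (\<iota> i (\<tau> i)) = g (\<iota> i (\<tau> i))"
    and x: "x \<in> carrier F"
  shows "f x = g x"
proof -
  have comp: "(\<lambda>t. k (\<iota> i t)) \<in> continuous_hom (subgrp G (T i)) (subtopology TG (T i)) H TH"
    if "i \<in> I" "k \<in> continuous_hom F TF H TH" for i k
  proof -
    have "\<iota> i \<in> continuous_hom (subgrp G (T i)) (subtopology TG (T i)) F TF"
      using F that(1) by (simp add: is_free_pro_p_product_def)
    then show ?thesis using that(2)
      by (auto simp: continuous_hom_def comp_def dest: continuous_map_compose hom_compose)
  qed
  have eqT: "f (\<iota> i t) = g (\<iota> i t)" if "i \<in> I" "t \<in> T i" for i t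
    using hom_eq_on_closed_subgroup_generated[OF G _ _ _ _ _ comp[OF that(1) f] comp[OF that(1) g], of "{\<tau> i}" t]
      T[OF that(1)] H eq that
    by (auto simp: pro_p_group_def profinite_group_def topological_group_def)
  have "pro_p_group p H TH \<and>
      (\<forall>i\<in>I. (\<lambda>t. f (\<iota> i t)) \<in> continuous_hom (subgrp G (T i)) (subtopology TG (T i)) H TH)"
    using H comp f by blast
  \<comment> \<open>The universal property for \<open>H\<close> and the maps \<open>f \<circ> \<iota> i\<close>; both \<open>f\<close> and \<open>g\<close> solve it.\<close>
  from mp[OF spec[OF spec[OF spec[OF conjunct2[OF conjunct2[OF F[unfolded is_free_pro_p_product_def]]],
        of H], of TH], of "\<lambda>i t. f (\<iota> i t)"] this]
  obtain h where "\<forall>h' \<in> continuous_hom F TF H TH.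
      (\<forall>i\<in>I. \<forall>a\<in>carrier (subgrp G (T i)). h' (\<iota> i a) = f (\<iota> i a)) \<longrightarrow> (\<forall>x\<in>carrier F. h' x = h x)"
    by (elim bexE conjE)
  then have "h' x = h x" if "h' \<in> continuous_hom F TF H TH"
      "\<And>i a. i \<in> I \<Longrightarrow> a \<in> T i \<Longrightarrow> h' (\<iota> i a) = f (\<iota> i a)" for h'
    using that x by simp
  from this[OF f] this[OF g] eqT show ?thesis by simp
qed

section \<open>Separation of the coefficient ring by finite quotients\<close>

lemma ZFact_repr:
  assumes "c \<in> carrier (ZFact k)" shows "\<exists>a. c = ZMod k a"
  using assms by (auto simp: ZFact_defs A_RCOSETS_defs ZMod_def a_r_coset_def RCOSETS_def)

lemma ZMod_hom:
  "ZMod k a \<oplus>\<^bsub>ZFact k\<^esub> ZMod k b = ZMod k (a + b)"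
  "ZMod k a \<otimes>\<^bsub>ZFact k\<^esub> ZMod k b = ZMod k (a * b)"
  "\<one>\<^bsub>ZFact k\<^esub> = ZMod k 1"
proof -
  interpret ideal "Idl\<^bsub>\<Z>\<^esub> {k}" \<Z> by (rule int.genideal_ideal) simp
  show "ZMod k a \<oplus>\<^bsub>ZFact k\<^esub> ZMod k b = ZMod k (a + b)"
    by (simp add: ZFact_defs ZMod_def a_rcos_sum)
  show "ZMod k a \<otimes>\<^bsub>ZFact k\<^esub> ZMod k b = ZMod k (a * b)"
    by (simp add: ZFact_defs ZMod_def rcoset_mult_add)
  show "\<one>\<^bsub>ZFact k\<^esub> = ZMod k 1"
    by (simp add: ZFact_defs ZMod_def)
qed

lemma ring_of_type_isoD:
  fixes x y :: "'r::comm_ring_1"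
  assumes "h \<in> ring_iso (ring_of_type TYPE('r)) S"
  shows "h (x + y) = h x \<oplus>\<^bsub>S\<^esub> h y" "h (x * y) = h x \<otimes>\<^bsub>S\<^esub> h y" "h 1 = \<one>\<^bsub>S\<^esub>"
    "h x \<in> carrier S" "inj h"
  using assms by (auto simp: ring_iso_def Ring.ring_hom_def ring_of_type_def bij_betw_def)

text \<open>
  Two distinct \<open>p\<close>-adic integers differ in some residue modulo \<open>p ^ m\<close>, and taking this residue is
  continuous.  For \<open>\<int>/p\<^sup>k\<close> a choice of representatives separates all elements.
\<close>
lemma coefficient_ring_residually_finite:
  fixes a b :: "'r::{comm_ring_1, topological_space}"
  assumes R: "is_coefficient_ring p TYPE('r)" and ab: "a \<noteq> b"
  obtains m \<theta> where "residue_map (p ^ m) \<theta>" "continuous_map euclidean (discrete_topology UNIV) \<theta>"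
    "\<theta> a mod int (p ^ m) \<noteq> \<theta> b mod int (p ^ m)"
proof -
  from R consider
    (padic) h where "h \<in> ring_iso (ring_of_type TYPE('r)) (padic_int p)"
      "homeomorphic_map euclidean (padic_topology p) h"
  | (ZFact) k h where "h \<in> ring_iso (ring_of_type TYPE('r)) (ZFact (int p ^ k))"
      "homeomorphic_map euclidean (discrete_topology (carrier (ZFact (int p ^ k)))) h"
    unfolding is_coefficient_ring_def by blast
  then show thesis
  proof cases
    case padic
    note h = ring_of_type_isoD[OF padic(1)]
    from h(5) ab have "h a \<noteq> h b" by (auto dest: injD)
    then obtain m where m: "h a m \<noteq> h b m" by (auto simp: fun_eq_iff)
    show thesis
    proof (rule that[of m "\<lambda>x. h x m"])
      show "residue_map (p ^ m) (\<lambda>x. h x m)"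
        by (simp add: residue_map_def h padic_int_def)
      have range: "h x m \<in> {0..<int p ^ m}" for x
        using h(4)[of x] by (simp add: padic_int_def)
      then have "h x m mod int p ^ m = h x m" for x by simp
      then show "h a m mod int (p ^ m) \<noteq> h b m mod int (p ^ m)" using m by simp
      have "continuous_map euclidean (product_topology (\<lambda>n. discrete_topology {0..<int p ^ n}) UNIV) h"
        using homeomorphic_imp_continuous_map[OF padic(2)]
        by (simp add: padic_topology_def continuous_map_in_subtopology)
      then have "continuous_map euclidean (discrete_topology {0..<int p ^ m}) (\<lambda>x. h x m)"
        by (simp add: continuous_map_componentwise_UNIV)
      from continuous_map_compose[OF this, of "discrete_topology UNIV" "\<lambda>z. z"]
      show "continuous_map euclidean (discrete_topology UNIV) (\<lambda>x. h x m)"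
        by (simp add: comp_def)
    qed
  next
    case ZFact
    let ?q = "int p ^ k"
    note h = ring_of_type_isoD[OF ZFact(1)]
    define rep where "rep c = (SOME z. c = ZMod ?q z)" for c
    define \<theta> where "\<theta> x = rep (h x)" for x
    have \<theta>: "ZMod ?q (\<theta> x) = h x" for x
      unfolding \<theta>_def rep_def using someI_ex[OF ZFact_repr[OF h(4)[of x]]] by simp
    show thesis
    proof (rule that[of k \<theta>])
      show "residue_map (p ^ k) \<theta>"
        by (simp add: residue_map_def flip: ZMod_eq_mod)
          (simp add: \<theta> h flip: ZMod_hom)
      show "\<theta> a mod int (p ^ k) \<noteq> \<theta> b mod int (p ^ k)"
        using h(5) ab by (auto simp: \<theta> simp flip: ZMod_eq_mod dest: injD)
      have "continuous_map euclidean (discrete_topology (carrier (ZFact ?q))) h"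
        using ZFact(2) by (rule homeomorphic_imp_continuous_map)
      from continuous_map_compose[OF this, of "discrete_topology UNIV" rep]
      show "continuous_map euclidean (discrete_topology UNIV) \<theta>"
        by (simp add: \<theta>_def[abs_def] comp_def)
    qed
  qed
qed

text \<open>
  Rigidity of homomorphisms to the unitriangular group over the whole coefficient ring.  This
  group need not have the carrier type of a test group, so an entry in which the two homomorphisms
  differ is first reduced modulo a power of \<open>p\<close> at which its two values still differ; after the
  reduction the target is a finite \<open>p\<close>-group.
\<close>
lemma unipotent_hom_unique:
  fixes f g :: "'t \<Rightarrow> 'r::{comm_ring_1, topological_space} mat"
  assumes p: "prime p" and R: "is_coefficient_ring p TYPE('r)"
    and G: "group G" "topspace TG = carrier G"
    and T: "\<And>i. i \<in> I \<Longrightarrow> subgroup (T i) G \<and> closedin TG (T i) \<and> \<tau> i \<in> T i \<and>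
              closed_subgroup_generated G TG {\<tau> i} = T i"
    and F: "is_free_pro_p_product p I (\<lambda>i. subgrp G (T i)) (\<lambda>i. subtopology TG (T i)) F TF \<iota>"
    and f: "f \<in> hom F (unipotent_group n)"
      "\<And>a b. a < b \<Longrightarrow> b \<le> n \<Longrightarrow> continuous_map TF euclidean (\<lambda>s. f s $$ (a, b))"
    and g: "g \<in> hom F (unipotent_group n)"
      "\<And>a b. a < b \<Longrightarrow> b \<le> n \<Longrightarrow> continuous_map TF euclidean (\<lambda>s. g s $$ (a, b))"
    and eq: "\<And>i. i \<in> I \<Longrightarrow> f (\<iota> i (\<tau> i)) = g (\<iota> i (\<tau> i))"
    and x: "x \<in> carrier F"
  shows "f x = g x"
proof -
  have TF: "topspace TF = carrier F"
    using F by (simp add: is_free_pro_p_product_def pro_p_group_def profinite_group_def topological_group_def)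
  have fx: "f x \<in> carrier (unipotent_group n)" and gx: "g x \<in> carrier (unipotent_group n)"
    using f(1) g(1) x by (auto simp: hom_def)
  have entry: "f x $$ (a, b) = g x $$ (a, b)" if ab: "a < b" "b \<le> n" for a b
  proof (rule ccontr)
    assume "f x $$ (a, b) \<noteq> g x $$ (a, b)"
    then obtain m \<theta> where \<theta>: "residue_map (p ^ m) \<theta>"
        "continuous_map euclidean (discrete_topology UNIV) \<theta>"
      and neq: "\<theta> (f x $$ (a, b)) mod int (p ^ m) \<noteq> \<theta> (g x $$ (a, b)) mod int (p ^ m)"
      using coefficient_ring_residually_finite[OF R] by blast
    let ?H = "unipotent_mod (p ^ m) n"
    let ?r = "\<lambda>M. reduce_mat (p ^ m) n (map_mat \<theta> M)"
    have q: "p ^ m > 0" using p by (simp add: prime_gt_0_nat)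
    have hom: "(\<lambda>s. ?r (k s)) \<in> continuous_hom F TF ?H (discrete_topology (carrier ?H))"
      if k: "k \<in> hom F (unipotent_group n)"
        "\<And>a b. a < b \<Longrightarrow> b \<le> n \<Longrightarrow> continuous_map TF euclidean (\<lambda>s. k s $$ (a, b))" for k
      using hom_compose[OF k(1) reduce_mat_hom[OF q \<theta>(1)]] k TF
      by (auto simp: continuous_hom_def comp_def hom_def intro!: continuous_map_reduce_mat[OF q \<theta>(2)])
    have "?r (f x) = ?r (g x)"
      by (rule free_pro_p_product_hom_unique[OF G T F pro_p_unipotent_mod[OF p] hom[OF f] hom[OF g] _ x])
        (simp_all add: eq)
    then show False
      using neq ab fx gx by (auto simp: reduce_mat_eq_iff[OF q] dest!: unipotent_carrier_mat)
  qed
  show ?thesis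
  proof (rule eq_matI)
    fix a b assume "a < dim_row (g x)" "b < dim_col (g x)"
    then have "a \<le> n" "b \<le> n" using unipotent_carrier_mat[OF gx] by auto
    then show "f x $$ (a, b) = g x $$ (a, b)"
      using entry[of a b] unipotent_entry[OF fx, of a b] unipotent_entry[OF gx, of a b]
      by (cases "a < b") auto
  qed (use unipotent_carrier_mat[OF fx] unipotent_carrier_mat[OF gx] in auto)
qed

lemma continuous_map_unipotent_entry:
  assumes "i \<le> n" "j \<le> n"
  shows "continuous_map (unipotent_topology n :: 'r::{comm_ring_1, topological_space} mat topology)
           euclidean (\<lambda>M. M $$ (i, j))"
proof -
  have "continuous_map (product_topology (\<lambda>_. euclidean :: 'r topology) ({..n} \<times> {..n})) euclidean (\<lambda>v. v (i, j))"
    using assms by (intro continuous_map_product_projection) auto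
  moreover have "(\<lambda>v. v (i, j)) \<circ> (\<lambda>M. restrict (\<lambda>ij. M $$ ij) ({..n} \<times> {..n})) = (\<lambda>M :: 'r mat. M $$ (i, j))"
    using assms by (simp add: fun_eq_iff)
  ultimately show ?thesis
    unfolding unipotent_topology_def by (metis continuous_map_pullback)
qed

section \<open>The unitriangular matrix of a formal power series\<close>

text \<open>
  The substitution of \<open>\<Sum> E\<close>, summed over the matrix units \<open>E = matrix_unit n l (Suc l)\<close> with
  \<open>w ! l = i\<close>, for each variable \<open>x\<^sub>i\<close>: a product of such units is nonzero only if their positions
  are consecutive, so a monomial contributes to an entry exactly if it spells that segment of \<open>w\<close>.
\<close>
definition subword_mat :: "'j list \<Rightarrow> ('j list \<Rightarrow> 'r::comm_ring_1) \<Rightarrow> 'r mat" where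
  "subword_mat w f = Matrix.mat (Suc (length w)) (Suc (length w))
     (\<lambda>(a, b). if a \<le> b then f (take (b - a) (drop a w)) else 0)"

lemma subword_mat_index:
  "a \<le> b \<Longrightarrow> b \<le> length w \<Longrightarrow> subword_mat w f $$ (a, b) = f (take (b - a) (drop a w))"
  by (simp add: subword_mat_def)

lemma subword_mat_unipotent:
  "f [] = 1 \<Longrightarrow> subword_mat w f \<in> carrier (unipotent_group (length w))"
  by (auto simp: unipotent_carrier_iff subword_mat_def)

text \<open>
  Cutting the segment from \<open>a\<close> to \<open>b\<close> into two parts is the choice of a position \<open>c\<close> with
  \<open>a \<le> c \<le> b\<close>, so the convolution of coefficients is the matrix product.
\<close>
lemma subword_mat_mult:
  assumes "f [] = 1" "g [] = 1"
  shows "subword_mat w (ncps_mult f g) = subword_mat w f * subword_mat w g"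
proof -
  let ?n = "length w"
  have f: "subword_mat w f \<in> carrier (unipotent_group ?n)"
    and g: "subword_mat w g \<in> carrier (unipotent_group ?n)"
    using assms by (simp_all add: subword_mat_unipotent)
  have fg: "subword_mat w (ncps_mult f g) \<in> carrier (unipotent_group ?n)"
    by (rule subword_mat_unipotent) (simp add: ncps_mult_def assms)
  note prod = unipotent_mult_closed[OF f g]
  show ?thesis
  proof (rule eq_matI)
    fix a b assume "a < dim_row (subword_mat w f * subword_mat w g)"
      "b < dim_col (subword_mat w f * subword_mat w g)"
    then have ab: "a \<le> ?n" "b \<le> ?n" using unipotent_carrier_mat[OF prod] by auto
    show "subword_mat w (ncps_mult f g) $$ (a, b) = (subword_mat w f * subword_mat w g) $$ (a, b)"
    proof (cases "a \<le> b")
      case True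
      let ?v = "take (b - a) (drop a w)"
      have "subword_mat w (ncps_mult f g) $$ (a, b) = (\<Sum>k\<le>b - a. f (take k ?v) * g (drop k ?v))"
        using True ab by (simp add: subword_mat_index ncps_mult_def)
      also have "\<dots> = (\<Sum>c=a..b. subword_mat w f $$ (a, c) * subword_mat w g $$ (c, b))"
        using True ab
        by (intro sum.reindex_bij_witness[of _ "\<lambda>c. c - a" "\<lambda>k. a + k"])
          (auto simp: subword_mat_index drop_take min_def add.commute)
      also have "\<dots> = (subword_mat w f * subword_mat w g) $$ (a, b)"
        using unipotent_index_mult[OF f g ab] by simp
      finally show ?thesis .
    next
      case False
      then show ?thesis
        using ab unipotent_entry[OF prod, of a b] unipotent_entry[OF fg, of a b] by simp
    qed
  qed (use unipotent_carrier_mat[OF prod] unipotent_carrier_mat[OF fg] in auto)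
qed

lemma subword_mat_hom: "subword_mat w \<in> hom (magnus_group I) (unipotent_group (length w))"
proof (rule homI)
  fix f g :: "'a list \<Rightarrow> 'b" assume "f \<in> carrier (magnus_group I)" "g \<in> carrier (magnus_group I)"
  then show "subword_mat w (f \<otimes>\<^bsub>magnus_group I\<^esub> g) =
      subword_mat w f \<otimes>\<^bsub>unipotent_group (length w)\<^esub> subword_mat w g"
    by (simp add: magnus_group_def unipotent_group_def subword_mat_mult)
qed (simp add: magnus_group_def subword_mat_unipotent)

text \<open>
  Since the letters of \<open>w\<close> are distinct, \<open>[i]\<close> occurs exactly once as a segment of \<open>w\<close>, and
  the matrix of \<open>1 + x\<^sub>i\<close> has a single nonzero entry off the diagonal.
\<close>
lemma subword_mat_generator:
  assumes w: "distinct w" and i: "i \<in> set w" and t: "\<pi>bar i t = 1"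
  shows "subword_mat w (\<lambda>v. ncps_one v + ncps_var i v) = linking_local_map w \<pi>bar i t"
proof -
  from i obtain l where l: "l < length w" "w ! l = i" by (auto simp: in_set_conv_nth)
  with w have the: "(THE l. l < length w \<and> w ! l = i) = l"
    by (auto simp: nth_eq_iff_index_eq intro!: the_equality)
  have "take (b - a) (drop a w) = [i] \<longleftrightarrow> a = l \<and> b = Suc l" if "a \<le> b" "b \<le> length w" for a b
  proof
    assume *: "take (b - a) (drop a w) = [i]"
    then have "length (take (b - a) (drop a w)) = 1" by simp
    then have b: "b = Suc a" using that by simp
    with * that have "w ! a = i" by (simp add: take_Suc_conv_app_nth flip: Cons_nth_drop_Suc)
    then have "a = l" using l w b that by (simp add: nth_eq_iff_index_eq[symmetric])
    with b show "a = l \<and> b = Suc l" by simp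
  next
    assume "a = l \<and> b = Suc l"
    then show "take (b - a) (drop a w) = [i]"
      using l by (simp flip: Cons_nth_drop_Suc)
  qed
  then show ?thesis
    using i t l
    by (intro eq_matI)
      (auto simp: linking_local_map_def the subword_mat_def matrix_unit_def ncps_one_def ncps_var_def)
qed

section \<open>The linking invariant as a Magnus coefficient\<close>

theorem corollary5p2:
  fixes p :: nat
    and G :: "('a, 'm) monoid_scheme" and TG :: "'a topology"
    and J Ihat :: "'j set" and w :: "'j list"
    and Z T :: "'j \<Rightarrow> 'a set" and \<tau> :: "'j \<Rightarrow> 'a"
    and \<pi>bar :: "'j \<Rightarrow> 'a \<Rightarrow> 'r::{comm_ring_1, topological_space}"
    and That :: "'t monoid" and TThat :: "'t topology" and \<iota> :: "'j \<Rightarrow> 'a \<Rightarrow> 't"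
    and lamT :: "'t \<Rightarrow> 'a set"
    and \<Lambda> :: "'t \<Rightarrow> 'j list \<Rightarrow> 'r"
    and \<rho> :: "'a set \<Rightarrow> 'r mat"
    and j :: 'j and \<sigma> :: 'a and \<sigma>hat :: 't
  defines "N \<equiv> kernel_outside G TG J T Ihat"
  defines "GI \<equiv> G Mod N"
  defines "TGI \<equiv> quotient_group_topology G TG N"
  defines "res \<equiv> (\<lambda>g. N #>\<^bsub>G\<^esub> g)"
  assumes "prime p"
    and "is_coefficient_ring p TYPE('r)"
    and "pro_p_group p G TG"
    and "\<And>k. k \<in> J \<Longrightarrow> subgroup (Z k) G \<and> closedin TG (Z k)"
    and "\<And>k. k \<in> J \<Longrightarrow> subgroup (T k) G \<and> closedin TG (T k)"
    and "\<And>k. k \<in> J \<Longrightarrow> T k \<lhd> subgrp G (Z k)"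
    and "\<And>k. k \<in> J \<Longrightarrow>
           topologically_isomorphic (subgrp G (T k)) (subtopology TG (T k))
             (add_monoid (padic_int p)) (padic_topology p)"
    and "\<And>k. k \<in> J \<Longrightarrow> \<tau> k \<in> T k \<and> closed_subgroup_generated G TG {\<tau> k} = T k"
    and "distinct w" and "length w \<ge> 1"
    and "set w \<subseteq> Ihat" and "Ihat \<subseteq> J"
    and "\<And>i. i \<in> set w \<Longrightarrow> splits_over G TG (Z i) (T i)"
    and "closed_subgroup_generated GI TGI (\<Union>i\<in>set w. res ` T i) = carrier GI"
    and "\<And>k. k \<in> J \<Longrightarrow>
           \<pi>bar k \<in> continuous_hom (subgrp G (T k)) (subtopology TG (T k)) additive_group euclidean
           \<and> \<pi>bar k ` T k = UNIV \<and> \<pi>bar k (\<tau> k) = 1"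
    and "is_free_pro_p_product p (set w) (\<lambda>i. subgrp G (T i)) (\<lambda>i. subtopology TG (T i)) That TThat \<iota>"
    and "lamT \<in> continuous_hom That TThat GI TGI"
    and "\<And>i t. i \<in> set w \<Longrightarrow> t \<in> T i \<Longrightarrow> lamT (\<iota> i t) = res t"
    and "is_magnus_hom (set w) That TThat (\<lambda>i. \<iota> i (\<tau> i)) \<Lambda>"
    and "is_globalization GI TGI T res \<pi>bar w \<rho>"
    and "j \<in> J - Ihat"
    and "\<rho> ` res ` Z j \<subseteq> corner_group (length w)"
    and "\<sigma> \<in> Z j"
    and "\<sigma>hat \<in> {s \<in> carrier That. lamT s \<in> res ` Z j}"
    and "res \<sigma> = lamT \<sigma>hat"
  shows "linking_invariant (length w) \<rho> res \<sigma> = \<Lambda> \<sigma>hat w"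
proof -
  have G: "group G" and TG: "topspace TG = carrier G"
    using \<open>pro_p_group p G TG\<close>
    by (simp_all add: pro_p_group_def profinite_group_def topological_group_def)
  have wJ: "i \<in> J" if "i \<in> set w" for i
    using that \<open>set w \<subseteq> Ihat\<close> \<open>Ihat \<subseteq> J\<close> by auto
  have T: "subgroup (T i) G \<and> closedin TG (T i) \<and> \<tau> i \<in> T i \<and>
      closed_subgroup_generated G TG {\<tau> i} = T i" if "i \<in> set w" for i
    using assms(9,12) wJ[OF that] by blast
  have \<rho>: "\<rho> \<in> continuous_hom GI TGI (unipotent_group (length w)) (unipotent_topology (length w))"
    "\<And>i t. i \<in> set w \<Longrightarrow> t \<in> T i \<Longrightarrow> \<rho> (res t) = linking_local_map w \<pi>bar i t"
    using \<open>is_globalization GI TGI T res \<pi>bar w \<rho>\<close> by (auto simp: is_globalization_def)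
  have \<Lambda>: "\<Lambda> \<in> continuous_hom That TThat (magnus_group (set w)) (magnus_topology (set w))"
    "\<And>i. i \<in> set w \<Longrightarrow> \<Lambda> (\<iota> i (\<tau> i)) = (\<lambda>v. ncps_one v + ncps_var i v)"
    using \<open>is_magnus_hom (set w) That TThat (\<lambda>i. \<iota> i (\<tau> i)) \<Lambda>\<close> by (auto simp: is_magnus_hom_def)
  note lamT = \<open>lamT \<in> continuous_hom That TThat GI TGI\<close>
  have \<rho>_hom: "(\<lambda>s. \<rho> (lamT s)) \<in> hom That (unipotent_group (length w))"
    using lamT \<rho>(1) hom_compose[of lamT That GI \<rho> "unipotent_group (length w)"]
    by (simp add: continuous_hom_def comp_def)
  have \<rho>_cont: "continuous_map TThat euclidean (\<lambda>s. \<rho> (lamT s) $$ (a, b))"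
    if "a < b" "b \<le> length w" for a b
  proof -
    have "continuous_map TGI euclidean ((\<lambda>M. M $$ (a, b)) \<circ> \<rho>)"
      using \<rho>(1) that by (intro continuous_map_compose[OF _ continuous_map_unipotent_entry])
        (auto simp: continuous_hom_def)
    from continuous_map_compose[OF _ this, of TThat lamT] lamT show ?thesis
      by (simp add: comp_def continuous_hom_def)
  qed
  have \<Lambda>_hom: "(\<lambda>s. subword_mat w (\<Lambda> s)) \<in> hom That (unipotent_group (length w))"
    using \<Lambda>(1) subword_mat_hom[of w "set w"]
      hom_compose[of \<Lambda> That "magnus_group (set w)" "subword_mat w" "unipotent_group (length w)"]
    by (simp add: continuous_hom_def comp_def)
  have \<Lambda>_cont: "continuous_map TThat euclidean (\<lambda>s. subword_mat w (\<Lambda> s) $$ (a, b))"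
    if "a < b" "b \<le> length w" for a b
    using \<Lambda>(1) that
    by (simp add: subword_mat_index continuous_hom_def magnus_topology_def
        continuous_map_in_subtopology continuous_map_componentwise_UNIV)
  have eq: "\<rho> (lamT (\<iota> i (\<tau> i))) = subword_mat w (\<Lambda> (\<iota> i (\<tau> i)))" if "i \<in> set w" for i
  proof -
    have "\<pi>bar i (\<tau> i) = 1" using assms(19)[OF wJ[OF that]] by simp
    from subword_mat_generator[where \<pi>bar = \<pi>bar, OF \<open>distinct w\<close> that this] show ?thesis
      using T[OF that] that by (simp add: assms(22) \<Lambda>(2) \<rho>(2))
  qed
  have \<sigma>hat: "\<sigma>hat \<in> carrier That" using assms(28) by simp
  have "\<rho> (lamT \<sigma>hat) = subword_mat w (\<Lambda> \<sigma>hat)"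
    by (rule unipotent_hom_unique[OF \<open>prime p\<close> \<open>is_coefficient_ring p TYPE('r)\<close> G TG _ assms(20)
          \<rho>_hom \<rho>_cont \<Lambda>_hom \<Lambda>_cont eq \<sigma>hat]) (fact T | assumption)+
  then show ?thesis
    using \<open>res \<sigma> = lamT \<sigma>hat\<close> by (simp add: linking_invariant_def subword_mat_index)
qed

end
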